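(* For every $\varepsilon>0$, there are infinitely many natural numbers $Q$ such that for suitable $M\in \mathbb{Z}$, $N\in \mathbb{N}$ and sequences $\{a_n\}$ of complex numbers, we have \[ \sum_{q=1}^Q \sum_{\substack{a=1 \\ (a,q)=1}}^{q^2} \left| \sum_{n=M+1}^{M+N} a_n e \left( \frac{an}{q^2} \right) \right|^2 \ge D\,Q^{\frac{\log 2}{(1+\varepsilon)\log \log Q}} (Q^3+N) \sum_{n=M+1}^{M+N} |a_n|^2, \] where $D$ is some absolute positive constant (independent of $\varepsilon$, $Q$, $M$, $N$ and the sequence).
   Context: Here $e(x)=e^{2\pi i x}$ for real $x$, and $(a,q)$ denotes the greatest common divisor of $a$ and $q$. *)

theory Defs
  imports Complex_Main
begin

definition e :: "real \<Rightarrow> complex" where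
  "e x = exp (2 * of_real pi * \<i> * of_real x)"

end

theory Submission
  imports Defs "HOL-Number_Theory.Number_Theory" "HOL-Real_Asymp.Real_Asymp"
begin

text \<open>
  Let \<open>r\<close> be the product of the odd primes up to \<open>x\<close> and \<open>Q = 2r\<close>. By the Chinese remainder theorem
  there are at least \<open>2 ^ (\<pi>(x) - 1)\<close> numbers \<open>q \<in> [r, 2r)\<close> with \<open>q\<^sup>2 \<equiv> 1\<close> modulo \<open>r\<close>. For each of
  them \<open>b = (q\<^sup>2 - 1) / r\<close> is coprime to \<open>q\<close> and \<open>1 / r - b / q\<^sup>2 = 1 / (r q\<^sup>2) \<le> 1 / r\<^sup>3\<close>, so these
  fractions cluster around \<open>1 / r\<close> at distance \<open>O(1 / Q\<^sup>3)\<close>. With \<open>a\<^sub>n = e(-n / r)\<close> and \<open>N\<close> a small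
  multiple of \<open>Q\<^sup>3\<close>, every one of them contributes at least \<open>N\<^sup>2 / 4\<close>. Finally
  \<open>ln Q \<le> \<pi>(x) ln x\<close>, and a weak Chebyshev bound gives \<open>ln x \<le> (1 + \<epsilon>) ln (ln Q)\<close> for large \<open>x\<close>,
  whence \<open>\<pi>(x) \<ge> ln Q / ((1 + \<epsilon>) ln (ln Q))\<close>.
\<close>

section \<open>A Chebyshev-type lower bound for the prime-counting function\<close>

text \<open>
  The entries \<open>1 / ((n + 1) (n choose k))\<close> of the Leibniz harmonic triangle are, by its recurrence, integer
  combinations of \<open>1, 1/2, \<dots>, 1/(n + 1)\<close>. This bounds common multiples from below without
  computing prime multiplicities of binomial coefficients.
\<close>
lemma leibniz_triangle_Ints:
  fixes d :: nat
  assumes "\<And>i. i \<in> {1..n + 1} \<Longrightarrow> i dvd d" and "k \<le> n"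
  shows "real d / (real (n + 1) * real (n choose k)) \<in> \<int>"
  using assms
proof (induction k arbitrary: n)
  case 0
  then have "n + 1 dvd d" by simp
  then obtain c where "d = (n + 1) * c" by (rule dvdE)
  then have "real d = real (n + 1) * real c" by (metis of_nat_mult)
  then show ?case by simp
next
  case (Suc k)
  then obtain m where n: "n = Suc m" and km: "k \<le> m" by (cases n) auto
  define A where "A = real (m + 1) * real (m choose k)"
  have A: "A > 0" using km by (simp add: A_def)
  have eq1: "real (k + 1) * real (Suc m choose Suc k) = A"
    unfolding A_def of_nat_mult[symmetric] using Suc_times_binomial[of k m]
    by (simp only: Suc_eq_plus1)
  have diff: "real m + 1 - real k = real (Suc m - k)"
    using km by (simp add: of_nat_diff)
  have eq2: "(real m + 1 - real k) * real (Suc m choose k) = A"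
    unfolding A_def diff of_nat_mult[symmetric] using binomial_absorb_comp[of "Suc m" k]
    by (simp only: diff_Suc_1 flip: Suc_eq_plus1)
  have inv: "1 / c = b / A" if "b * c = A" for b c
    using that A by (auto simp: field_simps)
  have inv1: "1 / real (Suc m choose Suc k) = real (k + 1) / A"
    using eq1 by (rule inv)
  have inv2: "1 / real (Suc m choose k) = (real m + 1 - real k) / A"
    using eq2 by (rule inv)
  \<comment> \<open>With \<open>s = m + 2\<close> and \<open>j = k\<close> this is the Leibniz
    recurrence: the entry at \<open>Suc k\<close> in row \<open>n = m + 1\<close> is the entry
    \<open>1 / A\<close> at \<open>k\<close> in row \<open>m\<close> minus its left neighbour in row
    \<open>n\<close>.\<close>
  have split: "1 / s * ((j + 1) / A) = 1 / A - 1 / s * ((s - 1 - j) / A)" if "s > 0" for s j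
    using that A by (simp add: field_simps)
  have "1 / (real (n + 1) * real (n choose Suc k)) = (1 / real (m + 2)) * (real (k + 1) / A)"
    unfolding n inv1[symmetric] by simp
  also have "\<dots> = 1 / A - (1 / real (m + 2)) * ((real m + 1 - real k) / A)"
    using split[of "real (m + 2)" "real k"] by (simp add: algebra_simps)
  also have "\<dots> = 1 / A - 1 / (real (n + 1) * real (n choose k))"
    unfolding n inv2[symmetric] by simp
  finally have "real d / (real (n + 1) * real (n choose Suc k)) =
      real d / A - real d / (real (n + 1) * real (n choose k))"
    by (metis (no_types, opaque_lifting) mult.right_neutral right_diff_distrib times_divide_eq_right)
  moreover have "real d / A \<in> \<int>"
    unfolding A_def by (rule Suc.IH) (use Suc.prems n km in auto)
  moreover have "real d / (real (n + 1) * real (n choose k)) \<in> \<int>"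
    by (rule Suc.IH) (use Suc.prems in auto)
  ultimately show ?case by simp
qed

text \<open>The middle entry of row 2n of the triangle makes d / ((2n + 1) (2n choose n)) a positive
  integer, hence at least 1, and the central binomial coefficient is at least 4^n / (2n).\<close>

lemma four_power_le_common_multiple:
  fixes d :: nat
  assumes "\<And>i. i \<in> {1..2 * n + 1} \<Longrightarrow> i dvd d" and "d > 0" and "n > 0"
  shows "4 ^ n \<le> real d"
proof -
  let ?B = "real ((2 * n) choose n)"
  have "real d / (real (2 * n + 1) * ?B) \<in> \<int>"
    using assms(1) by (intro leibniz_triangle_Ints) auto
  moreover have "real d / (real (2 * n + 1) * ?B) > 0"
    using assms(2) by simp
  ultimately have "real d / (real (2 * n + 1) * ?B) \<ge> 1"
    by (metis Ints_cases of_int_0_less_iff of_int_1_le_iff int_one_le_iff_zero_less)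
  then have "real (2 * n + 1) * ?B \<le> real d"
    by (subst (asm) le_divide_eq_1_pos) auto
  moreover have "4 ^ n / (2 * real n) \<le> ?B"
    using central_binomial_lower_bound[OF assms(3)] by simp
  then have "4 ^ n \<le> 2 * real n * ?B"
    using assms(3) by (simp add: field_simps)
  moreover have "2 * real n * ?B \<le> real (2 * n + 1) * ?B"
    by (intro mult_right_mono) auto
  ultimately show ?thesis by linarith
qed

text \<open>The witness is the least common multiple of 1, ..., x in factored form: each prime
  enters with its largest power not exceeding \<open>x\<close>, so each factor is at most
  \<open>x\<close>.\<close>

lemma exists_common_multiple_le:
  assumes "x > (0::nat)"
  shows "\<exists>d::nat. d > 0 \<and> (\<forall>i\<in>{1..x}. i dvd d) \<and> d \<le> x ^ card {p. prime p \<and> p \<le> x}"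
proof -
  let ?P = "{p. prime p \<and> p \<le> x}"
  define g where "g p = Max {k. p ^ k \<le> x}" for p :: nat
  define d where "d = (\<Prod>p\<in>?P. p ^ g p)"
  have fin: "finite {k. p ^ k \<le> x}" if "prime p" for p :: nat
  proof (rule finite_subset)
    show "{k. p ^ k \<le> x} \<subseteq> {..x}"
    proof
      fix k assume "k \<in> {k. p ^ k \<le> x}"
      moreover have "k < p ^ k" using prime_gt_1_nat[OF that] by (intro power_gt_expt) auto
      ultimately show "k \<in> {..x}" by simp
    qed
  qed simp
  have gle: "p ^ g p \<le> x" if "prime p" for p :: nat
  proof -
    have "0 \<in> {k. p ^ k \<le> x}" using assms by simp
    then have "{k. p ^ k \<le> x} \<noteq> {}" by blast
    with fin[OF that] have "g p \<in> {k. p ^ k \<le> x}"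
      unfolding g_def by (rule Max_in)
    then show ?thesis by simp
  qed
  have "d > 0" unfolding d_def by (intro prod_pos) (auto simp: prime_gt_0_nat)
  moreover have "i dvd d" if i: "i \<in> {1..x}" for i
  proof -
    have "i = (\<Prod>p\<in>prime_factors i. p ^ multiplicity p i)"
      using i by (simp add: prime_factorization_nat)
    also have "\<dots> dvd (\<Prod>p\<in>prime_factors i. p ^ g p)"
    proof (rule prod_dvd_prod)
      fix p assume p: "p \<in> prime_factors i"
      have "p ^ multiplicity p i dvd i" by (rule multiplicity_dvd)
      then have "p ^ multiplicity p i \<le> x" using i by (auto dest!: dvd_imp_le)
      then have "multiplicity p i \<le> g p"
        unfolding g_def using fin p by (intro Max_ge) auto
      then show "p ^ multiplicity p i dvd p ^ g p" by (rule le_imp_power_dvd)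
    qed
    also have "\<dots> dvd d"
      unfolding d_def using i
      by (intro prod_dvd_prod_subset) (auto dest!: dvd_imp_le)
    finally show ?thesis .
  qed
  moreover have "d \<le> (\<Prod>p\<in>?P. x)"
    unfolding d_def by (intro prod_mono) (auto intro: gle)
  ultimately show ?thesis by auto
qed

text \<open>The least common multiple of 1, ..., 2n + 1 is squeezed between the two preceding
  bounds; take logarithms.\<close>

lemma chebyshev_lower:
  assumes "n > (0::nat)"
  shows "real n * ln 4 \<le> real (card {p::nat. prime p \<and> p \<le> 2 * n + 1}) * ln (real (2 * n + 1))"
proof -
  let ?k = "card {p::nat. prime p \<and> p \<le> 2 * n + 1}"
  obtain d :: nat where d: "d > 0" "\<forall>i\<in>{1..2 * n + 1}. i dvd d" "d \<le> (2 * n + 1) ^ ?k"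
    using exists_common_multiple_le[of "2 * n + 1"] by auto
  have "4 ^ n \<le> real d"
    using d assms by (intro four_power_le_common_multiple) auto
  also have "\<dots> \<le> real (2 * n + 1) ^ ?k"
    using d(3) by (metis of_nat_le_iff of_nat_power)
  finally have "ln (4 ^ n) \<le> ln (real (2 * n + 1) ^ ?k)"
    by simp
  then show ?thesis by (simp add: ln_realpow)
qed

section \<open>Square roots of 1 modulo a product of odd primes\<close>

text \<open>Choosing a sign independently modulo each prime in \<open>A\<close> gives one root per
  subset of \<open>A\<close>. Adding \<open>r\<close> to the root below \<open>r\<close> ensures q
  >= r, which later keeps 1 / (r q^2) below 1 / r^3.\<close>

lemma two_power_card_le_square_roots:
  fixes A :: "nat set"
  assumes fin: "finite A" and A: "\<And>p. p \<in> A \<Longrightarrow> prime p \<and> 2 < p"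
  defines "r \<equiv> \<Prod>A"
  shows "2 ^ card A \<le> card {q \<in> {r..<2 * r}. [q ^ 2 = 1] (mod r)}"
proof -
  \<comment> \<open>The residue \<open>p - 1\<close> plays the part of -1 in \<open>nat\<close>;
    \<open>S\<close> is the set of primes with sign +1.\<close>
  define u where "u S p = (if p \<in> S then 1 else p - 1)" for S and p :: nat
  have cop: "\<forall>i\<in>A. \<forall>j\<in>A. i \<noteq> j \<longrightarrow> coprime i j"
    using A primes_coprime by blast
  have "\<exists>q. q < r \<and> (\<forall>p\<in>A. [q = u S p] (mod p))" for S
    using chinese_remainder_unique_nat[of A "\<lambda>p. p" "u S"] fin A cop
    unfolding r_def by (metis (no_types, lifting) not_prime_0)
  then obtain f where f: "\<And>S. f S < r" "\<And>S p. p \<in> A \<Longrightarrow> [f S = u S p] (mod p)"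
    by metis
  have dvd: "p dvd r" if "p \<in> A" for p
    unfolding r_def using fin that by auto
  have "inj_on (\<lambda>S. r + f S) (Pow A)"
  proof (rule inj_onI)
    fix S T assume S: "S \<in> Pow A" and T: "T \<in> Pow A" and eq: "r + f S = r + f T"
    have "p \<in> S \<longleftrightarrow> p \<in> T" if p: "p \<in> A" for p
    proof -
      have "[u S p = u T p] (mod p)"
        using f(2)[OF p, of S] f(2)[OF p, of T] eq by (metis add_left_imp_eq cong_sym cong_trans)
      \<comment> \<open>Both values are residues below \<open>p\<close>, and since
        \<open>p > 2\<close> the values 1 and \<open>p - 1\<close> differ, so the root determines
        the sign.\<close>
      then have "u S p = u T p"
        using A[OF p] by (intro cong_less_modulus_unique_nat) (auto simp: u_def)
      then show ?thesis using A[OF p] by (auto simp: u_def split: if_splits)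
    qed
    then show "S = T" using S T by blast
  qed
  moreover have "(\<lambda>S. r + f S) ` Pow A \<subseteq> {q \<in> {r..<2 * r}. [q ^ 2 = 1] (mod r)}"
  proof safe
    fix S
    have "[(r + f S) ^ 2 = 1] (mod \<Prod>A)"
    proof (rule coprime_cong_prod_nat[where m = "\<lambda>p. p", simplified])
      fix p assume p: "p \<in> A"
      have "[r = 0] (mod p)" using dvd[OF p] by (simp add: cong_0_iff)
      then have "[r + f S = 0 + u S p] (mod p)" using f(2)[OF p] by (rule cong_add)
      then have "[(r + f S) ^ 2 = u S p ^ 2] (mod p)" by (intro cong_pow) simp
      moreover have "[u S p ^ 2 = 1] (mod p)"
      proof (cases "p \<in> S")
        case False
        have "p * (p - 2) + 1 = (p - 1) ^ 2"
          using A[OF p] by (cases p) (auto simp: power2_eq_square algebra_simps numeral_2_eq_2 Suc_diff_Suc diff_mult_distrib2)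
        moreover have "[p * (p - 2) + 1 = 1] (mod p)" 
          by (subst cong_add_rcancel_0_nat) (simp add: cong_0_iff)
        ultimately show ?thesis using False by (simp add: u_def)
      qed (simp add: u_def)
      ultimately show "[(r + f S) ^ 2 = 1] (mod p)" by (rule cong_trans)
    qed (use A primes_coprime in blast)
    then show "[(r + f S) ^ 2 = 1] (mod r)" by (simp add: r_def)
  qed (use f(1) in auto)
  ultimately have "card (Pow A) \<le> card {q \<in> {r..<2 * r}. [q ^ 2 = 1] (mod r)}"
    by (intro card_inj_on_le) auto
  then show ?thesis by (simp add: card_Pow fin)
qed

section \<open>Exponential sums at fractions close to 1 / r\<close>

lemma cmod_e [simp]: "cmod (e t) = 1"
  by (simp add: e_def)

lemma e_add: "e (s + t) = e s * e t"
  by (simp add: e_def exp_add algebra_simps)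

lemma Re_e_ge_half:
  assumes "\<bar>t\<bar> \<le> 1 / 6"
  shows "Re (e t) \<ge> 1 / 2"
proof -
  have "Re (e t) = cos (2 * pi * \<bar>t\<bar>)"
    by (cases "t \<ge> 0") (auto simp: e_def Re_exp)
  also have "\<dots> \<ge> cos (pi / 3)"
    using assms pi_gt_zero by (intro cos_monotone_0_pi_le) (auto simp: field_simps)
  finally show ?thesis by (simp add: cos_60)
qed

text \<open>A single \<open>b\<close> suffices: at b / q^2 the twist by e(-n / r) leaves phases of
  size at most 1/6, so each term has real part at least 1/2 and nothing cancels. All other
  \<open>b\<close> are dropped by nonnegativity.\<close>

lemma large_sieve_contribution:
  fixes r q N :: nat
  assumes r: "r \<ge> 3" and q: "r \<le> q" and cong: "[q ^ 2 = 1] (mod r)" and N: "6 * N \<le> r ^ 3"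
  shows "real N ^ 2 / 4 \<le> (\<Sum>b | b \<in> {1..q ^ 2} \<and> coprime b q.
      (cmod (\<Sum>n = 1..int N. e (- real_of_int n / real r) * e (real b * real_of_int n / real q ^ 2))) ^ 2)"
    (is "_ \<le> (\<Sum>b \<in> ?B. ?F b)")
proof -
  have q2: "q ^ 2 > 1" using r q by (intro one_less_power) auto
  then obtain b where b: "q ^ 2 = r * b + 1"
    using cong cong_to_1_nat[OF cong] by (metis add.commute dvdE le_add_diff_inverse less_imp_le)
  have b0: "b > 0" using q2 b by (cases b) auto
  \<comment> \<open>A common divisor of \<open>b\<close> and q^2 = r b + 1 divides 1.\<close>
  have "coprime (r * b + 1) b"
    by (metis coprime_1_left coprime_iff_gcd_eq_1 gcd.commute gcd_add_mult add.commute mult.commute)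
  then have cop: "coprime b q" unfolding b[symmetric] by (simp add: coprime_commute)
  have "1 * b \<le> r * b" using r by (intro mult_right_mono) auto
  then have "b \<le> q ^ 2" unfolding b by linarith
  then have mem: "b \<in> ?B" using cop b0 by auto
  have bR: "real q ^ 2 = real r * real b + 1"
    using arg_cong[OF b, of real] by simp
  have pos: "real r > 0" "real q > 0" using r q by auto
  let ?t = "\<lambda>n::int. - real_of_int n / real r + real b * real_of_int n / real q ^ 2"
  have "1 / real r - 1 / (real r * real q ^ 2) = (real q ^ 2 - 1) / (real r * real q ^ 2)"
    using pos by (simp add: diff_divide_distrib)
  also have "\<dots> = (real r * real b) / (real r * real q ^ 2)" unfolding bR by simp
  also have "\<dots> = real b / real q ^ 2" using pos by simp
  finally have bq: "real b / real q ^ 2 = 1 / real r - 1 / (real r * real q ^ 2)" ..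
  have t: "?t n = - (real_of_int n / (real r * real q ^ 2))" for n
  proof -
    have "?t n = (real b / real q ^ 2 - 1 / real r) * real_of_int n"
      by (simp add: left_diff_distrib)
    then show ?thesis by (simp add: bq)
  qed
  have small: "\<bar>?t n\<bar> \<le> 1 / 6" if "n \<in> {1..int N}" for n
  proof -
    \<comment> \<open>The phase has size n / (r q^2), so the bound needed is 6 n <= r q^2; it
      follows from 6 N <= r^3 and r <= q.\<close>
    have "6 * real_of_int n \<le> 6 * real N" using that by simp
    also have "\<dots> \<le> real r ^ 3" using N by (metis of_nat_le_iff of_nat_mult of_nat_numeral of_nat_power)
    also have "\<dots> = real r * real r ^ 2" by (simp add: power3_eq_cube power2_eq_square)
    also have "\<dots> \<le> real r * real q ^ 2" using q by (intro mult_left_mono power_mono) auto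
    finally show ?thesis unfolding t using that pos by (simp add: field_simps)
  qed
  let ?S = "\<Sum>n = 1..int N. e (- real_of_int n / real r) * e (real b * real_of_int n / real q ^ 2)"
  have "real N / 2 = (\<Sum>n = 1..int N. 1 / 2)" by simp
  also have "\<dots> \<le> (\<Sum>n = 1..int N. Re (e (?t n)))"
    by (intro sum_mono Re_e_ge_half small)
  also have "\<dots> = Re ?S" by (simp only: e_add Re_sum)
  also have "\<dots> \<le> cmod ?S" by (rule complex_Re_le_cmod)
  finally have "(real N / 2) ^ 2 \<le> cmod ?S ^ 2" by (intro power_mono) auto
  then have "real N ^ 2 / 4 \<le> ?F b" by (simp add: power_divide)
  also have "\<dots> \<le> (\<Sum>b \<in> ?B. ?F b)"
    using mem by (intro member_le_sum) auto
  finally show ?thesis .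
qed

section \<open>The lower bound for the double sum when Q is a primorial\<close>

lemma large_sieve_primorial:
  fixes x :: nat
  assumes x: "x \<ge> 3"
  defines "P \<equiv> {p. prime p \<and> p \<le> x}"
  defines "Q \<equiv> \<Prod>P"
  shows "\<exists>(N::nat) (a::int \<Rightarrow> complex). N \<ge> 1 \<and> (\<forall>n. cmod (a n) = 1) \<and>
     (\<Sum>q = 1..Q. \<Sum>b | b \<in> {1..q ^ 2} \<and> coprime b q.
       (cmod (\<Sum>n = 1..int N. a n * e (real b * real_of_int n / real q ^ 2))) ^ 2)
     \<ge> 1 / 1000 * 2 ^ card P * (real Q ^ 3 + real N) * real N"
proof -
  define A where "A = {p. prime p \<and> p \<le> x \<and> 2 < p}"
  define r where "r = \<Prod>A"
  \<comment> \<open>The greatest length permitted by the phase condition 6 N <= r^3.\<close>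
  define N where "N = r ^ 3 div 6"
  define a where "a n = e (- real_of_int n / real r)" for n :: int
  have fin: "finite A" by (rule finite_subset[of _ "{..x}"]) (auto simp: A_def)
  have P: "P = insert 2 A"
    using x by (auto simp: P_def A_def dest: prime_ge_2_nat)
  have "2 \<notin> A" by (simp add: A_def)
  then have Q: "Q = 2 * r" and card: "card P = Suc (card A)"
    using fin by (simp_all add: Q_def P r_def)
  have "r > 0" unfolding r_def by (intro prod_pos) (auto simp: A_def)
  \<comment> \<open>Since \<open>x >= 3\<close>, the prime 3 lies in \<open>A\<close>. Then r^3 >=
    27, so \<open>N\<close> is positive and rounding in the division by 6 costs at most a factor
    2.\<close>
  moreover have "3 dvd r"
    unfolding r_def using fin x by (intro dvd_prodI) (auto simp: A_def)
  ultimately have r: "r \<ge> 3" by (auto dest: dvd_imp_le)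
  have "3 ^ 3 \<le> r ^ 3" using r by (intro power_mono) auto
  then have N: "6 * N \<le> r ^ 3" "r ^ 3 \<le> 12 * N" "N \<ge> 1" unfolding N_def by simp_all
  let ?F = "\<lambda>q. \<Sum>b | b \<in> {1..q ^ 2} \<and> coprime b q.
       (cmod (\<Sum>n = 1..int N. a n * e (real b * real_of_int n / real q ^ 2))) ^ 2"
  let ?T = "{q \<in> {r..<2 * r}. [q ^ 2 = 1] (mod r)}"
  have "real (2 ^ card A) \<le> real (card ?T)"
    unfolding of_nat_le_iff r_def
    by (rule two_power_card_le_square_roots[OF fin]) (auto simp: A_def)
  then have "2 ^ card A * (real N ^ 2 / 4) \<le> real (card ?T) * (real N ^ 2 / 4)"
    by (intro mult_right_mono) auto
  also have "\<dots> = (\<Sum>q\<in>?T. real N ^ 2 / 4)" by simp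
  also have "\<dots> \<le> (\<Sum>q\<in>?T. ?F q)"
    unfolding a_def using r N(1) by (intro sum_mono large_sieve_contribution) auto
  also have "\<dots> \<le> (\<Sum>q = 1..Q. ?F q)"
    using r by (intro sum_mono2) (auto simp: Q intro!: sum_nonneg)
  finally have main: "2 ^ card A * (real N ^ 2 / 4) \<le> (\<Sum>q = 1..Q. ?F q)" .
  have "real r ^ 3 \<le> 12 * real N"
    using N(2) by (metis of_nat_le_iff of_nat_mult of_nat_numeral of_nat_power)
  \<comment> \<open>97 = 8 * 12 + 1, from Q^3 = 8 r^3 and r^3 <= 12 N.\<close>
  then have "real Q ^ 3 + real N \<le> 97 * real N" by (simp add: Q power_mult_distrib)
  then have "1 / 1000 * 2 ^ card P * (real Q ^ 3 + real N) * real N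
      \<le> 1 / 1000 * 2 ^ card P * (97 * real N) * real N"
    by (intro mult_right_mono mult_left_mono) auto
  \<comment> \<open>The prime 2 in \<open>P\<close> costs a factor 2, and 2 * 97 / 1000 <=
    1/4.\<close>
  also have "\<dots> \<le> 2 ^ card A * (real N ^ 2 / 4)"
    by (simp add: card power2_eq_square)
  also note main
  finally have "1 / 1000 * 2 ^ card P * (real Q ^ 3 + real N) * real N \<le> (\<Sum>q = 1..Q. ?F q)" .
  moreover have "\<forall>n. cmod (a n) = 1" by (simp add: a_def)
  ultimately show ?thesis
    using N(3) by blast
qed

section \<open>Comparison of the power of Q with the number of square roots\<close>

lemma primorial_exponent_eventually:
  fixes \<epsilon> :: real
  assumes "\<epsilon> > 0"
  shows "eventually (\<lambda>n::nat. real (\<Prod>{p. prime p \<and> p \<le> 2 * n + 1}) powr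
      (ln 2 / ((1 + \<epsilon>) * ln (ln (real (\<Prod>{p. prime p \<and> p \<le> 2 * n + 1})))))
      \<le> 2 ^ card {p::nat. prime p \<and> p \<le> 2 * n + 1}) at_top"
proof -
  \<comment> \<open>The argument of the outer logarithm is the Chebyshev bound times ln 2, which
    will be a lower bound for ln Q because Q >= 2^k. It has order n / ln n, so its logarithm is
    asymptotic to ln n and the factor \<open>1 + \<epsilon>\<close> gives the slack.\<close>
  have "eventually (\<lambda>n::nat. ln (2 * real n + 1) \<le>
      (1 + \<epsilon>) * ln (ln 2 * (real n * ln 4 / ln (2 * real n + 1)))) at_top"
    using assms by real_asymp
  then show ?thesis
    using eventually_gt_at_top[of 1]
  proof eventually_elim
    case (elim n)
    let ?x = "2 * n + 1"
    define P where "P = {p::nat. prime p \<and> p \<le> ?x}"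
    define Q where "Q = \<Prod>P"
    define k where "k = card P"
    have lnx: "ln (real ?x) > 0" using elim by (intro ln_gt_zero) auto
    have "2 ^ k \<le> Q"
      unfolding Q_def k_def using prod_mono[of P "\<lambda>_. 2" "\<lambda>p. p"] by (auto simp: P_def prime_ge_2_nat)
    then have Q2: "2 ^ k \<le> real Q" by (metis of_nat_le_iff of_nat_numeral of_nat_power)
    have "Q \<le> ?x ^ k"
      unfolding Q_def k_def using prod_mono[of P "\<lambda>p. p" "\<lambda>_. ?x"] by (auto simp: P_def)
    then have Qx: "real Q \<le> real ?x ^ k" by (metis of_nat_le_iff of_nat_power)
    have Q0: "real Q > 0" using Q2 by (meson less_le_trans zero_less_numeral zero_less_power)
    have "real n * ln 4 / ln (real ?x) \<le> real k"
      using chebyshev_lower[of n] elim lnx by (simp add: k_def P_def field_simps)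
    then have "ln 2 * (real n * ln 4 / ln (real ?x)) \<le> ln 2 * real k"
      by (intro mult_left_mono) auto
    also have "\<dots> = ln (2 ^ k)" by (simp add: ln_realpow)
    also have "\<dots> \<le> ln (real Q)" using Q2 Q0 by simp
    finally have le: "ln 2 * (real n * ln 4 / ln (real ?x)) \<le> ln (real Q)" .
    have arg0: "ln 2 * (real n * ln 4 / ln (real ?x)) > 0" using elim lnx by simp
    have "ln (real ?x) \<le> (1 + \<epsilon>) * ln (ln 2 * (real n * ln 4 / ln (real ?x)))"
      using elim by (simp add: add.commute)
    also have "\<dots> \<le> (1 + \<epsilon>) * ln (ln (real Q))"
      using assms le arg0 by (intro mult_left_mono) auto
    finally have xQ: "ln (real ?x) \<le> (1 + \<epsilon>) * ln (ln (real Q))" .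
    have "ln (real Q) \<le> ln (real ?x ^ k)" using Qx Q0 by simp
    also have "\<dots> = real k * ln (real ?x)" by (simp add: ln_realpow)
    also have "\<dots> \<le> real k * ((1 + \<epsilon>) * ln (ln (real Q)))"
      using xQ by (intro mult_left_mono) auto
    \<comment> \<open>Division is legitimate because the denominator is at least ln(2n + 1) >
      0.\<close>
    finally have "ln (real Q) / ((1 + \<epsilon>) * ln (ln (real Q))) \<le> real k"
      using less_le_trans[OF lnx xQ] by (subst pos_divide_le_eq)
    then have "ln 2 * (ln (real Q) / ((1 + \<epsilon>) * ln (ln (real Q)))) \<le> ln 2 * real k"
      by (intro mult_left_mono) auto
    then have "exp (ln 2 / ((1 + \<epsilon>) * ln (ln (real Q))) * ln (real Q)) \<le> exp (real k * ln 2)"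
      by (simp add: mult.commute)
    then have "real Q powr (ln 2 / ((1 + \<epsilon>) * ln (ln (real Q)))) \<le> 2 ^ k"
      using Q0 by (simp add: powr_def exp_of_nat_mult)
    then show ?case unfolding Q_def k_def P_def .
  qed
qed

section \<open>Infinitely many admissible Q\<close>

lemma primorial_unbounded: "\<exists>m. \<forall>n\<ge>m. (B::nat) < \<Prod>{p. prime p \<and> p \<le> 2 * n + 1}"
proof -
  obtain p :: nat where p: "prime p" "p > B" using bigger_prime by blast
  have "B < \<Prod>{p. prime p \<and> p \<le> 2 * n + 1}" if "n \<ge> p" for n
  proof -
    have "p dvd \<Prod>{p. prime p \<and> p \<le> 2 * n + 1}"
      using p that by (intro dvd_prodI) auto
    moreover have "\<Prod>{p. prime p \<and> p \<le> 2 * n + 1} > 0"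
      by (intro prod_pos) (auto simp: prime_gt_0_nat)
    ultimately show ?thesis using p(2) by (meson dvd_imp_le less_le_trans)
  qed
  then show ?thesis by blast
qed

theorem theorem1:
  shows "\<exists>D::real. D > 0 \<and>
    (\<forall>\<epsilon>::real. \<epsilon> > 0 \<longrightarrow>
      infinite {Q::nat. \<exists>(M::int) (N::nat) (a::int \<Rightarrow> complex).
        N \<ge> 1 \<and>
        (\<exists>n\<in>{M + 1..M + int N}. a n \<noteq> 0) \<and>
        (\<Sum>q = 1..Q. \<Sum>b | b \<in> {1..q ^ 2} \<and> coprime b q.
            (cmod (\<Sum>n = M + 1..M + int N. a n * e (real b * real_of_int n / real q ^ 2))) ^ 2)
          \<ge> D * real Q powr (ln 2 / ((1 + \<epsilon>) * ln (ln (real Q)))) *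
              (real Q ^ 3 + real N) * (\<Sum>n = M + 1..M + int N. (cmod (a n)) ^ 2)})"
proof (intro exI[of _ "1 / 1000"] conjI allI impI)
  fix \<epsilon> :: real assume \<epsilon>: "\<epsilon> > 0"
  show "infinite {Q::nat. \<exists>(M::int) (N::nat) (a::int \<Rightarrow> complex).
        N \<ge> 1 \<and>
        (\<exists>n\<in>{M + 1..M + int N}. a n \<noteq> 0) \<and>
        (\<Sum>q = 1..Q. \<Sum>b | b \<in> {1..q ^ 2} \<and> coprime b q.
            (cmod (\<Sum>n = M + 1..M + int N. a n * e (real b * real_of_int n / real q ^ 2))) ^ 2)
          \<ge> 1 / 1000 * real Q powr (ln 2 / ((1 + \<epsilon>) * ln (ln (real Q)))) *
              (real Q ^ 3 + real N) * (\<Sum>n = M + 1..M + int N. (cmod (a n)) ^ 2)}"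
    unfolding infinite_nat_iff_unbounded
  proof (intro allI)
    fix B :: nat
    obtain m where m: "\<And>n. n \<ge> m \<Longrightarrow> B < \<Prod>{p. prime p \<and> p \<le> 2 * n + 1}"
      using primorial_unbounded by blast
    obtain m' where m': "\<And>n::nat. n \<ge> m' \<Longrightarrow> real (\<Prod>{p. prime p \<and> p \<le> 2 * n + 1}) powr
        (ln 2 / ((1 + \<epsilon>) * ln (ln (real (\<Prod>{p. prime p \<and> p \<le> 2 * n + 1})))))
        \<le> 2 ^ card {p::nat. prime p \<and> p \<le> 2 * n + 1}"
      using primorial_exponent_eventually[OF \<epsilon>] unfolding eventually_at_top_linorder by blast
    \<comment> \<open>The 1 guarantees \<open>2 * n + 1 >= 3\<close>, as the primorial bound
      requires.\<close>
    define n where "n = max 1 (max m m')"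
    define P where "P = {p::nat. prime p \<and> p \<le> 2 * n + 1}"
    define Q where "Q = \<Prod>P"
    have B: "B < Q" unfolding Q_def P_def by (rule m) (simp add: n_def)
    have pw: "real Q powr (ln 2 / ((1 + \<epsilon>) * ln (ln (real Q)))) \<le> 2 ^ card P"
      unfolding Q_def P_def by (rule m') (simp add: n_def)
    obtain N a where N: "N \<ge> 1" and a: "\<And>n. cmod (a n) = 1" and
      main: "(\<Sum>q = 1..Q. \<Sum>b | b \<in> {1..q ^ 2} \<and> coprime b q.
       (cmod (\<Sum>n = 1..int N. a n * e (real b * real_of_int n / real q ^ 2))) ^ 2)
     \<ge> 1 / 1000 * 2 ^ card P * (real Q ^ 3 + real N) * real N"
      using large_sieve_primorial[of "2 * n + 1"] unfolding Q_def P_def n_def by auto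
    have "1 / 1000 * real Q powr (ln 2 / ((1 + \<epsilon>) * ln (ln (real Q)))) *
              (real Q ^ 3 + real N) * real N
        \<le> 1 / 1000 * 2 ^ card P * (real Q ^ 3 + real N) * real N"
      by (intro mult_right_mono mult_left_mono pw) auto
    note le = order_trans[OF this main]
    have "a 1 \<noteq> 0" using a[of 1] by auto
    then have "\<exists>n\<in>{0 + 1..0 + int N}. a n \<noteq> 0" using N by (intro bexI[of _ 1]) auto
    then show "\<exists>Q>B. Q \<in> {Q::nat. \<exists>(M::int) (N::nat) (a::int \<Rightarrow> complex).
        N \<ge> 1 \<and>
        (\<exists>n\<in>{M + 1..M + int N}. a n \<noteq> 0) \<and>
        (\<Sum>q = 1..Q. \<Sum>b | b \<in> {1..q ^ 2} \<and> coprime b q.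
            (cmod (\<Sum>n = M + 1..M + int N. a n * e (real b * real_of_int n / real q ^ 2))) ^ 2)
          \<ge> 1 / 1000 * real Q powr (ln 2 / ((1 + \<epsilon>) * ln (ln (real Q)))) *
              (real Q ^ 3 + real N) * (\<Sum>n = M + 1..M + int N. (cmod (a n)) ^ 2)}"
      \<comment> \<open>Take M = 0. All coefficients have modulus 1, so the sum of their squared
        moduli is \<open>N\<close>.\<close>
      using B N le a by (intro exI[of _ Q] conjI CollectI exI[of _ 0] exI[of _ N] exI[of _ a]) simp_all
  qed
qed simp

end
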